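(* Let $(L,[\cdot,\cdot],\{\cdot,\cdot,\cdot\})$ be a Lie-Yamaguti algebra over $\mathbb{K}$ with $H^2(L,L)\times H^3(L,L)=0$. Then $L$ is analytically rigid, i.e. every 1-parameter formal deformation of $L$ is equivalent to the null deformation $([\cdot,\cdot],\{\cdot,\cdot,\cdot\})$.
   Context: $\mathbb{K}$ is an algebraically closed field of characteristic different from 2 and 3. **Lie-Yamaguti algebra.** A $\mathbb{K}$-vector space $L$ with a bilinear operation $[\cdot,\cdot]$ and a trilinear operation $\{\cdot,\cdot,\cdot\}$ such that for all $x,y,z,u,v,w\in L$ (where $\circlearrowleft_{(x,y,z)}$ denotes the sum over cyclic permutations of $x,y,z$): (LY1) $[x,y]=-[y,x]$; (LY2) $\{x,y,z\}=-\{y,x,z\}$; (LY3) $\circlearrowleft_{(x,y,z)}([[x,y],z]+\{x,y,z\})=0$; (LY4) $\circlearrowleft_{(x,y,z)}\{[x,y],z,u\}=0$; (LY5) $\{x,y,[u,v]\}=[\{x,y,u\},v]+[u,\{x,y,v\}]$; (LY6) $\{x,y,\{u,v,w\}\}=\{\{x,y,u\},v,w\}+\{u,\{x,y,v\},w\}+\{u,v,\{x,y,w\}\}$. The same definition is used over $\mathbb{K}[[t]]$ (with $\mathbb{K}[[t]]$-multilinear operations). **Formal deformations.** $L[[t]]$ is the $\mathbb{K}[[t]]$-module of formal power series with coefficients in $L$. A 1-parameter formal deformation of $L$ is a pair $(f_t,g_t)$, $f_t=\sum_{i\ge0}f_it^i$, $g_t=\sum_{i\ge0}g_it^i$, with $f_0=[\cdot,\cdot]$,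 $g_0=\{\cdot,\cdot,\cdot\}$, each $f_i:L\times L\to L$ $\mathbb{K}$-bilinear and each $g_i:L\times L\times L\to L$ $\mathbb{K}$-trilinear (extended $\mathbb{K}[[t]]$-multilinearly to $L[[t]]$), such that $(L[[t]],f_t,g_t)$ is a Lie-Yamaguti algebra over $\mathbb{K}[[t]]$. The null deformation is $(f_t,g_t)=(f_0,g_0)$. **Equivalence.** $(f_t,g_t)$ and $(f'_t,g'_t)$ are equivalent if there is a formal isomorphism of $\mathbb{K}[[t]]$-modules $\phi_t=\sum_{i\ge0}\phi_it^i:L[[t]]\to L[[t]]$, with each $\phi_i:L\to L$ $\mathbb{K}$-linear (extended $\mathbb{K}[[t]]$-linearly) and $\phi_0=\mathrm{id}_L$, such that $\phi_t(f_t(x,y))=f'_t(\phi_t(x),\phi_t(y))$ and $\phi_t(g_t(x,y,z))=g'_t(\phi_t(x),\phi_t(y),\phi_t(z))$. A deformation is trivial if it is equivalent to the null deformation; $L$ is analytically rigid if every 1-parameter formal deformation of $L$ is trivial. **Cohomology (adjoint coefficients).** $C^n(L,L)$ is the space of $n$-linear maps $f:L^n\to L$ with $f(x_1,\dots,x_n)=0$ whenever $x_{2i-1}=x_{2i}$ for some $i$ with $2i\le n$. (So $C^1(L,L)$ is the space of linear maps.) For $h\in C^1(L,L)$: $\delta^1_Ih(x,y)=[x,h(y)]-[y,h(x)]-h([x,y])$, $\delta^1_{II}h(x,y,z)=\{h(x),y,z\}-\{h(y),x,z\}+\{x,y,h(z)\}-h(\{x,y,z\})$. For $(f,g)\in C^2(L,L)\times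 C^3(L,L)$, $\delta(f,g)=(\delta_If,\delta_{II}g)$, where $(\delta_If)(x_1,\dots,x_4)=[x_3,g(x_1,x_2,x_4)]-[x_4,g(x_1,x_2,x_3)]-g(x_1,x_2,[x_3,x_4])-\{x_1,x_2,f(x_3,x_4)\}+f(\{x_1,x_2,x_3\},x_4)+f(x_3,\{x_1,x_2,x_4\})$ (this depends on both $f$ and $g$), $(\delta_{II}g)(x_1,\dots,x_5)=\{g(x_1,x_2,x_3),x_4,x_5\}-\{g(x_1,x_2,x_4),x_3,x_5\}-\{x_1,x_2,g(x_3,x_4,x_5)\}+\{x_3,x_4,g(x_1,x_2,x_5)\}+g(\{x_1,x_2,x_3\},x_4,x_5)+g(x_3,\{x_1,x_2,x_4\},x_5)+g(x_3,x_4,\{x_1,x_2,x_5\})-g(x_1,x_2,\{x_3,x_4,x_5\})$. Set $Z^2(L,L)\times Z^3(L,L):=\{(f,g)\in C^2(L,L)\times C^3(L,L):\delta(f,g)=(0,0)\}$, $B^2(L,L)\times B^3(L,L):=\{(\delta^1_Ih,\delta^1_{II}h):h\in C^1(L,L)\}$, and $H^2(L,L)\times H^3(L,L):=(Z^2(L,L)\times Z^3(L,L))/(B^2(L,L)\times B^3(L,L))$. The product symbols here are notation for a single subspace of $C^2\times C^3$ and a single quotient space. *)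

theory Defs
  imports
    "HOL-Computational_Algebra.Computational_Algebra"
    "HOL-Library.Function_Algebras"
    "HOL-Library.Product_Plus"
begin

section \<open>Lie-Yamaguti algebras over a commutative ring\<close>

definition bilinear_op ::
    "('r::comm_ring_1 \<Rightarrow> 'm::ab_group_add \<Rightarrow> 'm) \<Rightarrow> ('m \<Rightarrow> 'm \<Rightarrow> 'm) \<Rightarrow> bool" where
  "bilinear_op scale f \<longleftrightarrow>
     (\<forall>y. module_hom scale scale (\<lambda>x. f x y)) \<and>
     (\<forall>x. module_hom scale scale (\<lambda>y. f x y))"

definition trilinear_op ::
    "('r::comm_ring_1 \<Rightarrow> 'm::ab_group_add \<Rightarrow> 'm) \<Rightarrow> ('m \<Rightarrow> 'm \<Rightarrow> 'm \<Rightarrow> 'm) \<Rightarrow> bool" where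
  "trilinear_op scale g \<longleftrightarrow>
     (\<forall>y z. module_hom scale scale (\<lambda>x. g x y z)) \<and>
     (\<forall>x z. module_hom scale scale (\<lambda>y. g x y z)) \<and>
     (\<forall>x y. module_hom scale scale (\<lambda>z. g x y z))"

definition cyclic_sum :: "('m \<Rightarrow> 'm \<Rightarrow> 'm \<Rightarrow> 'm::ab_group_add) \<Rightarrow> 'm \<Rightarrow> 'm \<Rightarrow> 'm \<Rightarrow> 'm" where
  "cyclic_sum F x y z = F x y z + F y z x + F z x y"

text \<open>
  The scalars form an arbitrary commutative ring, so that the same notion applies to vector spaces
  over a field \<open>K\<close> (where \<^locale>\<open>module\<close> has the axioms of \<^locale>\<open>vector_space\<close>)
  and to modules over \<open>K[[t]]\<close>.  The underlying module is the whole type.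
\<close>

locale lie_yamaguti = module scale
  for scale :: "'r::comm_ring_1 \<Rightarrow> 'm::ab_group_add \<Rightarrow> 'm" +
  fixes br :: "'m \<Rightarrow> 'm \<Rightarrow> 'm"
    and tr :: "'m \<Rightarrow> 'm \<Rightarrow> 'm \<Rightarrow> 'm"
  assumes bilinear: "bilinear_op scale br"
    and trilinear: "trilinear_op scale tr"
    and LY1: "br x y = - br y x"
    and LY2: "tr x y z = - tr y x z"
    and LY3: "cyclic_sum (\<lambda>x y z. br (br x y) z + tr x y z) x y z = 0"
    and LY4: "cyclic_sum (\<lambda>x y z. tr (br x y) z u) x y z = 0"
    and LY5: "tr x y (br u v) = br (tr x y u) v + br u (tr x y v)"
    and LY6: "tr x y (tr u v w) = tr (tr x y u) v w + tr u (tr x y v) w + tr u v (tr x y w)"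


section \<open>Formal deformations\<close>

text \<open>
  \<open>L[[t]]\<close> is the type \<^typ>\<open>'v fps\<close>, whose additive structure is coefficientwise and does not
  require a multiplication on \<^typ>\<open>'v\<close>; the ring \<open>K[[t]]\<close> is \<^typ>\<open>'k fps\<close>.
\<close>

definition fps_scale ::
    "('k::comm_ring_1 \<Rightarrow> 'v::ab_group_add \<Rightarrow> 'v) \<Rightarrow> 'k fps \<Rightarrow> 'v fps \<Rightarrow> 'v fps" where
  "fps_scale scale c X = Abs_fps (\<lambda>n. \<Sum>i\<le>n. scale (fps_nth c i) (fps_nth X (n - i)))"

text \<open>
  The \<open>K[[t]]\<close>-multilinear extension to \<open>L[[t]]\<close> of a formal series of multilinear maps on \<open>L\<close>,
  one version for each number of arguments.  All index sets are finite.
\<close>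

definition fps_ext1 :: "(nat \<Rightarrow> 'v \<Rightarrow> 'v::ab_group_add) \<Rightarrow> 'v fps \<Rightarrow> 'v fps" where
  "fps_ext1 h X = Abs_fps (\<lambda>n. \<Sum>(i, j) \<in> {(i, j). i + j = n}. h i (fps_nth X j))"

definition fps_ext2 ::
    "(nat \<Rightarrow> 'v \<Rightarrow> 'v \<Rightarrow> 'v::ab_group_add) \<Rightarrow> 'v fps \<Rightarrow> 'v fps \<Rightarrow> 'v fps" where
  "fps_ext2 f X Y = Abs_fps (\<lambda>n. \<Sum>(i, j, k) \<in> {(i, j, k). i + j + k = n}.
     f i (fps_nth X j) (fps_nth Y k))"

definition fps_ext3 ::
    "(nat \<Rightarrow> 'v \<Rightarrow> 'v \<Rightarrow> 'v \<Rightarrow> 'v::ab_group_add) \<Rightarrow> 'v fps \<Rightarrow> 'v fps \<Rightarrow> 'v fps \<Rightarrow> 'v fps" where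
  "fps_ext3 g X Y Z = Abs_fps (\<lambda>n. \<Sum>(i, j, k, l) \<in> {(i, j, k, l). i + j + k + l = n}.
     g i (fps_nth X j) (fps_nth Y k) (fps_nth Z l))"

definition formal_deformation ::
    "('k::comm_ring_1 \<Rightarrow> 'v::ab_group_add \<Rightarrow> 'v) \<Rightarrow> ('v \<Rightarrow> 'v \<Rightarrow> 'v) \<Rightarrow> ('v \<Rightarrow> 'v \<Rightarrow> 'v \<Rightarrow> 'v) \<Rightarrow>
     (nat \<Rightarrow> 'v \<Rightarrow> 'v \<Rightarrow> 'v) \<Rightarrow> (nat \<Rightarrow> 'v \<Rightarrow> 'v \<Rightarrow> 'v \<Rightarrow> 'v) \<Rightarrow> bool" where
  "formal_deformation scale br tr f g \<longleftrightarrow>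
     f 0 = br \<and> g 0 = tr \<and>
     (\<forall>i. bilinear_op scale (f i)) \<and> (\<forall>i. trilinear_op scale (g i)) \<and>
     lie_yamaguti (fps_scale scale) (fps_ext2 f) (fps_ext3 g)"

definition equivalent_deformations ::
    "('k::comm_ring_1 \<Rightarrow> 'v::ab_group_add \<Rightarrow> 'v) \<Rightarrow>
     (nat \<Rightarrow> 'v \<Rightarrow> 'v \<Rightarrow> 'v) \<Rightarrow> (nat \<Rightarrow> 'v \<Rightarrow> 'v \<Rightarrow> 'v \<Rightarrow> 'v) \<Rightarrow>
     (nat \<Rightarrow> 'v \<Rightarrow> 'v \<Rightarrow> 'v) \<Rightarrow> (nat \<Rightarrow> 'v \<Rightarrow> 'v \<Rightarrow> 'v \<Rightarrow> 'v) \<Rightarrow> bool" where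
  "equivalent_deformations scale f g f' g' \<longleftrightarrow>
     (\<exists>\<phi>. (\<forall>i. module_hom scale scale (\<phi> i)) \<and> \<phi> 0 = id \<and>
        module_hom (fps_scale scale) (fps_scale scale) (fps_ext1 \<phi>) \<and> bij (fps_ext1 \<phi>) \<and>
        (\<forall>X Y. fps_ext1 \<phi> (fps_ext2 f X Y) = fps_ext2 f' (fps_ext1 \<phi> X) (fps_ext1 \<phi> Y)) \<and>
        (\<forall>X Y Z. fps_ext1 \<phi> (fps_ext3 g X Y Z) =
           fps_ext3 g' (fps_ext1 \<phi> X) (fps_ext1 \<phi> Y) (fps_ext1 \<phi> Z)))"

text \<open>The series with constant term \<open>a\<close> and no other terms.\<close>

definition const_series :: "'a::zero \<Rightarrow> nat \<Rightarrow> 'a" where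
  "const_series a i = (if i = 0 then a else 0)"

definition trivial_deformation ::
    "('k::comm_ring_1 \<Rightarrow> 'v::ab_group_add \<Rightarrow> 'v) \<Rightarrow> ('v \<Rightarrow> 'v \<Rightarrow> 'v) \<Rightarrow> ('v \<Rightarrow> 'v \<Rightarrow> 'v \<Rightarrow> 'v) \<Rightarrow>
     (nat \<Rightarrow> 'v \<Rightarrow> 'v \<Rightarrow> 'v) \<Rightarrow> (nat \<Rightarrow> 'v \<Rightarrow> 'v \<Rightarrow> 'v \<Rightarrow> 'v) \<Rightarrow> bool" where
  "trivial_deformation scale br tr f g \<longleftrightarrow>
     equivalent_deformations scale f g (const_series br) (const_series tr)"

definition analytically_rigid ::
    "('k::comm_ring_1 \<Rightarrow> 'v::ab_group_add \<Rightarrow> 'v) \<Rightarrow> ('v \<Rightarrow> 'v \<Rightarrow> 'v) \<Rightarrow> ('v \<Rightarrow> 'v \<Rightarrow> 'v \<Rightarrow> 'v) \<Rightarrow> bool" where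
  "analytically_rigid scale br tr \<longleftrightarrow>
     (\<forall>f g. formal_deformation scale br tr f g \<longrightarrow> trivial_deformation scale br tr f g)"


section \<open>Cohomology with adjoint coefficients\<close>

definition C1 :: "('k::comm_ring_1 \<Rightarrow> 'v::ab_group_add \<Rightarrow> 'v) \<Rightarrow> ('v \<Rightarrow> 'v) set" where
  "C1 scale = {h. module_hom scale scale h}"

definition C2 :: "('k::comm_ring_1 \<Rightarrow> 'v::ab_group_add \<Rightarrow> 'v) \<Rightarrow> ('v \<Rightarrow> 'v \<Rightarrow> 'v) set" where
  "C2 scale = {f. bilinear_op scale f \<and> (\<forall>x1 x2. x1 = x2 \<longrightarrow> f x1 x2 = 0)}"

definition C3 :: "('k::comm_ring_1 \<Rightarrow> 'v::ab_group_add \<Rightarrow> 'v) \<Rightarrow> ('v \<Rightarrow> 'v \<Rightarrow> 'v \<Rightarrow> 'v) set" where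
  "C3 scale = {g. trilinear_op scale g \<and> (\<forall>x1 x2 x3. x1 = x2 \<longrightarrow> g x1 x2 x3 = 0)}"

definition delta1_I :: "('v \<Rightarrow> 'v \<Rightarrow> 'v::ab_group_add) \<Rightarrow> ('v \<Rightarrow> 'v) \<Rightarrow> 'v \<Rightarrow> 'v \<Rightarrow> 'v" where
  "delta1_I br h x y = br x (h y) - br y (h x) - h (br x y)"

definition delta1_II ::
    "('v \<Rightarrow> 'v \<Rightarrow> 'v \<Rightarrow> 'v::ab_group_add) \<Rightarrow> ('v \<Rightarrow> 'v) \<Rightarrow> 'v \<Rightarrow> 'v \<Rightarrow> 'v \<Rightarrow> 'v" where
  "delta1_II tr h x y z = tr (h x) y z - tr (h y) x z + tr x y (h z) - h (tr x y z)"

definition delta_I ::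
    "('v \<Rightarrow> 'v \<Rightarrow> 'v::ab_group_add) \<Rightarrow> ('v \<Rightarrow> 'v \<Rightarrow> 'v \<Rightarrow> 'v) \<Rightarrow>
     ('v \<Rightarrow> 'v \<Rightarrow> 'v) \<Rightarrow> ('v \<Rightarrow> 'v \<Rightarrow> 'v \<Rightarrow> 'v) \<Rightarrow> 'v \<Rightarrow> 'v \<Rightarrow> 'v \<Rightarrow> 'v \<Rightarrow> 'v" where
  "delta_I br tr f g x1 x2 x3 x4 =
     br x3 (g x1 x2 x4) - br x4 (g x1 x2 x3) - g x1 x2 (br x3 x4)
     - tr x1 x2 (f x3 x4) + f (tr x1 x2 x3) x4 + f x3 (tr x1 x2 x4)"

definition delta_II ::
    "('v \<Rightarrow> 'v \<Rightarrow> 'v \<Rightarrow> 'v::ab_group_add) \<Rightarrow> ('v \<Rightarrow> 'v \<Rightarrow> 'v \<Rightarrow> 'v) \<Rightarrow>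
     'v \<Rightarrow> 'v \<Rightarrow> 'v \<Rightarrow> 'v \<Rightarrow> 'v \<Rightarrow> 'v" where
  "delta_II tr g x1 x2 x3 x4 x5 =
     tr (g x1 x2 x3) x4 x5 - tr (g x1 x2 x4) x3 x5 - tr x1 x2 (g x3 x4 x5) + tr x3 x4 (g x1 x2 x5)
     + g (tr x1 x2 x3) x4 x5 + g x3 (tr x1 x2 x4) x5 + g x3 x4 (tr x1 x2 x5)
     - g x1 x2 (tr x3 x4 x5)"

definition delta ::
    "('v \<Rightarrow> 'v \<Rightarrow> 'v::ab_group_add) \<Rightarrow> ('v \<Rightarrow> 'v \<Rightarrow> 'v \<Rightarrow> 'v) \<Rightarrow>
     ('v \<Rightarrow> 'v \<Rightarrow> 'v) \<times> ('v \<Rightarrow> 'v \<Rightarrow> 'v \<Rightarrow> 'v) \<Rightarrow>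
     ('v \<Rightarrow> 'v \<Rightarrow> 'v \<Rightarrow> 'v \<Rightarrow> 'v) \<times> ('v \<Rightarrow> 'v \<Rightarrow> 'v \<Rightarrow> 'v \<Rightarrow> 'v \<Rightarrow> 'v)" where
  "delta br tr = (\<lambda>(f, g). (delta_I br tr f g, delta_II tr g))"

text \<open>
  \<open>Z23\<close>, \<open>B23\<close> and \<open>H23\<close> stand for \<open>Z\<^sup>2 \<times> Z\<^sup>3\<close>, \<open>B\<^sup>2 \<times> B\<^sup>3\<close> and \<open>H\<^sup>2 \<times> H\<^sup>3\<close>, which are each a
  single space, not a product of two.  Pairs of cochains are added and subtracted pointwise.
\<close>

definition Z23 ::
    "('k::comm_ring_1 \<Rightarrow> 'v::ab_group_add \<Rightarrow> 'v) \<Rightarrow> ('v \<Rightarrow> 'v \<Rightarrow> 'v) \<Rightarrow> ('v \<Rightarrow> 'v \<Rightarrow> 'v \<Rightarrow> 'v) \<Rightarrow>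
     (('v \<Rightarrow> 'v \<Rightarrow> 'v) \<times> ('v \<Rightarrow> 'v \<Rightarrow> 'v \<Rightarrow> 'v)) set" where
  "Z23 scale br tr = {p \<in> C2 scale \<times> C3 scale. delta br tr p = (0, 0)}"

definition B23 ::
    "('k::comm_ring_1 \<Rightarrow> 'v::ab_group_add \<Rightarrow> 'v) \<Rightarrow> ('v \<Rightarrow> 'v \<Rightarrow> 'v) \<Rightarrow> ('v \<Rightarrow> 'v \<Rightarrow> 'v \<Rightarrow> 'v) \<Rightarrow>
     (('v \<Rightarrow> 'v \<Rightarrow> 'v) \<times> ('v \<Rightarrow> 'v \<Rightarrow> 'v \<Rightarrow> 'v)) set" where
  "B23 scale br tr = (\<lambda>h. (delta1_I br h, delta1_II tr h)) ` C1 scale"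

definition cohomologous ::
    "('k::comm_ring_1 \<Rightarrow> 'v::ab_group_add \<Rightarrow> 'v) \<Rightarrow> ('v \<Rightarrow> 'v \<Rightarrow> 'v) \<Rightarrow> ('v \<Rightarrow> 'v \<Rightarrow> 'v \<Rightarrow> 'v) \<Rightarrow>
     (('v \<Rightarrow> 'v \<Rightarrow> 'v) \<times> ('v \<Rightarrow> 'v \<Rightarrow> 'v \<Rightarrow> 'v)) rel" where
  "cohomologous scale br tr =
     {(p, q). p \<in> Z23 scale br tr \<and> q \<in> Z23 scale br tr \<and> p - q \<in> B23 scale br tr}"

definition H23 ::
    "('k::comm_ring_1 \<Rightarrow> 'v::ab_group_add \<Rightarrow> 'v) \<Rightarrow> ('v \<Rightarrow> 'v \<Rightarrow> 'v) \<Rightarrow> ('v \<Rightarrow> 'v \<Rightarrow> 'v \<Rightarrow> 'v) \<Rightarrow>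
     (('v \<Rightarrow> 'v \<Rightarrow> 'v) \<times> ('v \<Rightarrow> 'v \<Rightarrow> 'v \<Rightarrow> 'v)) set set" where
  "H23 scale br tr = Z23 scale br tr // cohomologous scale br tr"

text \<open>The zero of the quotient space is the class of the zero cocycle.\<close>

definition H23_zero ::
    "('k::comm_ring_1 \<Rightarrow> 'v::ab_group_add \<Rightarrow> 'v) \<Rightarrow> ('v \<Rightarrow> 'v \<Rightarrow> 'v) \<Rightarrow> ('v \<Rightarrow> 'v \<Rightarrow> 'v \<Rightarrow> 'v) \<Rightarrow>
     (('v \<Rightarrow> 'v \<Rightarrow> 'v) \<times> ('v \<Rightarrow> 'v \<Rightarrow> 'v \<Rightarrow> 'v)) set" where
  "H23_zero scale br tr = cohomologous scale br tr `` {0}"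


section \<open>Well-definedness of the module and of the quotient\<close>

lemma module_fps_scale:
  assumes "module scale"
  shows "module (fps_scale scale)"
proof -
  interpret module scale by fact
  show ?thesis
  proof
    fix a b :: "'a fps" and x y :: "'b fps"
    show "fps_scale scale a (x + y) = fps_scale scale a x + fps_scale scale a y"
      by (simp add: fps_scale_def fps_eq_iff scale_right_distrib sum.distrib)
    show "fps_scale scale (a + b) x = fps_scale scale a x + fps_scale scale b x"
      by (simp add: fps_scale_def fps_eq_iff scale_left_distrib sum.distrib)
    show "fps_scale scale 1 x = x"
    proof (rule fps_ext)
      fix n
      have "fps_nth (fps_scale scale 1 x) n
          = (\<Sum>i\<le>n. if i = 0 then fps_nth x (n - i) else 0)"
        unfolding fps_scale_def fps_nth_Abs_fps by (intro sum.cong) auto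
      then show "fps_nth (fps_scale scale 1 x) n = fps_nth x n" by simp
    qed
    show "fps_scale scale a (fps_scale scale b x) = fps_scale scale (a * b) x"
    proof (rule fps_ext)
      fix n
      let ?F = "\<lambda>i j. scale (fps_nth a i * fps_nth b j) (fps_nth x (n - (i + j)))"
      have "fps_nth (fps_scale scale a (fps_scale scale b x)) n = (\<Sum>i\<le>n. \<Sum>j\<le>n - i. ?F i j)"
        by (simp add: fps_scale_def scale_sum_right)
      also have "\<dots> = (\<Sum>(i, j) \<in> {(i, j). i + j \<le> n}. ?F i j)"
        by (subst sum.Sigma) (auto intro!: sum.cong)
      also have "\<dots> = (\<Sum>k\<le>n. \<Sum>i\<le>k. ?F i (k - i))"
        by (rule sum.triangle_reindex_eq)
      also have "\<dots> = fps_nth (fps_scale scale (a * b) x) n"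
        by (simp add: fps_scale_def fps_mult_nth scale_sum_left atLeast0AtMost)
      finally show "fps_nth (fps_scale scale a (fps_scale scale b x)) n
          = fps_nth (fps_scale scale (a * b) x) n" .
    qed
  qed
qed

context lie_yamaguti
begin

lemma br_hom: "module_hom scale scale (\<lambda>x. br x y)" "module_hom scale scale (br x)"
  using bilinear by (simp_all add: bilinear_op_def)

lemma tr_hom: "module_hom scale scale (\<lambda>x. tr x y z)" "module_hom scale scale (\<lambda>y. tr x y z)"
  "module_hom scale scale (tr x y)"
  using trilinear by (simp_all add: trilinear_op_def)

lemmas multilinear_simps =
  br_hom[THEN module_hom.add] br_hom[THEN module_hom.diff] br_hom[THEN module_hom.scale]
  br_hom[THEN module_hom.neg]
  tr_hom[THEN module_hom.add] tr_hom[THEN module_hom.diff] tr_hom[THEN module_hom.scale]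
  tr_hom[THEN module_hom.neg]

text \<open>The axiom \<open>LY1\<close> gives only \<open>2 [x, x] = 0\<close>, hence the hypothesis on 2-torsion.\<close>

lemma B23_subset_Z23:
  assumes two: "\<And>x::'m. x + x = 0 \<Longrightarrow> x = 0"
  shows "B23 scale br tr \<subseteq> Z23 scale br tr"
proof
  fix p assume "p \<in> B23 scale br tr"
  then obtain h where h: "module_hom scale scale h" and p: "p = (delta1_I br h, delta1_II tr h)"
    by (auto simp: B23_def C1_def)
  note h_simps = module_hom.add[OF h] module_hom.diff[OF h] module_hom.scale[OF h]
    module_hom.neg[OF h]
  have br_self: "br x x = 0" for x
    using two[of "br x x"] LY1[of x x] by (metis add.right_inverse)
  have tr_self: "tr x x y = 0" for x y
    using two[of "tr x x y"] LY2[of x x y] by (metis add.right_inverse)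
  have h0: "h 0 = 0" by (rule module_hom.zero[OF h])
  have hom: "module_hom scale scale F \<longleftrightarrow>
      (\<forall>x y. F (x + y) = F x + F y) \<and> (\<forall>r x. F (scale r x) = scale r (F x))" for F
    by (simp add: module_hom_iff module_axioms)
  have C2: "delta1_I br h \<in> C2 scale"
    by (simp add: C2_def bilinear_op_def hom delta1_I_def multilinear_simps h_simps br_self h0
        algebra_simps)
  have C3: "delta1_II tr h \<in> C3 scale"
    by (simp add: C3_def trilinear_op_def hom delta1_II_def multilinear_simps h_simps tr_self h0
        algebra_simps)
  have "delta_I br tr (delta1_I br h) (delta1_II tr h) x1 x2 x3 x4 = 0" for x1 x2 x3 x4
  proof -
    have s1: "br (tr a b c) (h d) = - br (h d) (tr a b c)"
      "br (tr a b c) x3 = - br x3 (tr a b c)" "br (tr a b c) x4 = - br x4 (tr a b c)" for a b c d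
      by (rule LY1)+
    have s2: "tr x1 (h x2) z = - tr (h x2) x1 z" for z by (rule LY2)
    show ?thesis
      by (simp add: delta_I_def delta1_I_def delta1_II_def multilinear_simps h_simps LY5 s1 s2
          algebra_simps)
  qed
  moreover have "delta_II tr (delta1_II tr h) x1 x2 x3 x4 x5 = 0" for x1 x2 x3 x4 x5
  proof -
    have s: "tr x3 (h u) z = - tr (h u) x3 z" "tr x4 (h u) z = - tr (h u) x4 z"
      "tr x3 (tr a b c) z = - tr (tr a b c) x3 z" "tr x4 (tr a b c) z = - tr (tr a b c) x4 z"
      "tr (h u) (tr a b c) z = - tr (tr a b c) (h u) z"
      for a b c u z by (rule LY2)+
    show ?thesis
      by (simp add: delta_II_def delta1_II_def multilinear_simps h_simps s
          LY6[of x1 x2] LY6[of "h x1" x2] LY6[of "h x2" x1] algebra_simps)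
  qed
  ultimately show "p \<in> Z23 scale br tr"
    using C2 C3 by (simp add: p Z23_def delta_def fun_eq_iff)
qed

lemma B23_zero: "0 \<in> B23 scale br tr"
proof -
  have "(\<lambda>x. 0) \<in> C1 scale"
    by (simp add: C1_def module_hom_iff module_axioms)
  moreover have "(0::'m \<Rightarrow> 'm \<Rightarrow> 'm) = delta1_I br (\<lambda>x. 0)"
    by (simp add: fun_eq_iff delta1_I_def br_hom[THEN module_hom.zero])
  moreover have "(0::'m \<Rightarrow> 'm \<Rightarrow> 'm \<Rightarrow> 'm) = delta1_II tr (\<lambda>x. 0)"
    by (simp add: fun_eq_iff delta1_II_def tr_hom[THEN module_hom.zero])
  ultimately show ?thesis
    unfolding B23_def zero_prod_def by (metis (mono_tags, lifting) imageI)
qed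

lemma B23_diff:
  assumes "p \<in> B23 scale br tr" "q \<in> B23 scale br tr"
  shows "p - q \<in> B23 scale br tr"
proof -
  obtain h k where h: "module_hom scale scale h" "p = (delta1_I br h, delta1_II tr h)"
    and k: "module_hom scale scale k" "q = (delta1_I br k, delta1_II tr k)"
    using assms by (auto simp: B23_def C1_def)
  have "(\<lambda>x. h x - k x) \<in> C1 scale"
    using h(1) k(1) by (auto simp: C1_def module_hom_iff algebra_simps)
  moreover have "p - q = (delta1_I br (\<lambda>x. h x - k x), delta1_II tr (\<lambda>x. h x - k x))"
    by (simp add: h(2) k(2) fun_eq_iff delta1_I_def delta1_II_def multilinear_simps algebra_simps)
  ultimately show ?thesis unfolding B23_def by blast
qed

lemma Z23_zero: "0 \<in> Z23 scale br tr"
  by (simp add: Z23_def zero_prod_def C2_def C3_def bilinear_op_def trilinear_op_def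
      module_hom_iff module_axioms delta_def fun_eq_iff delta_I_def delta_II_def
      br_hom[THEN module_hom.zero] tr_hom[THEN module_hom.zero])

lemma equiv_cohomologous: "equiv (Z23 scale br tr) (cohomologous scale br tr)"
proof (rule equivI)
  show "refl_on (Z23 scale br tr) (cohomologous scale br tr)"
    by (auto simp: refl_on_def cohomologous_def B23_zero)
  show "sym (cohomologous scale br tr)"
    using B23_diff[OF B23_zero] by (force simp: sym_def cohomologous_def)
  show "trans (cohomologous scale br tr)"
  proof (rule transI)
    fix p q r
    assume "(p, q) \<in> cohomologous scale br tr" and "(q, r) \<in> cohomologous scale br tr"
    then have Z: "p \<in> Z23 scale br tr" "r \<in> Z23 scale br tr"
      and B: "p - q \<in> B23 scale br tr" "q - r \<in> B23 scale br tr"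
      by (auto simp: cohomologous_def)
    have "p - r = (p - q) - (0 - (q - r))" by simp
    also have "\<dots> \<in> B23 scale br tr" by (intro B23_diff[OF B(1)] B23_diff[OF B23_zero] B(2))
    finally show "(p, r) \<in> cohomologous scale br tr"
      using Z by (simp add: cohomologous_def)
  qed
qed (auto simp: cohomologous_def)

lemma H23_zero_in_H23: "H23_zero scale br tr \<in> H23 scale br tr"
  unfolding H23_def H23_zero_def by (rule quotientI) (rule Z23_zero)

lemma H23_zero_eq_B23:
  assumes "\<And>x::'m. x + x = 0 \<Longrightarrow> x = 0"
  shows "H23_zero scale br tr = B23 scale br tr"
  using B23_subset_Z23[OF assms] B23_diff[OF B23_zero] Z23_zero
  by (force simp: H23_zero_def cohomologous_def)

end

end

theory Submission
  imports Defs
begin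

text \<open>
  Build \<open>\<phi>\<^sub>t\<close> one coefficient at a time.  Suppose \<open>\<phi>\<^sub>t(f\<^sub>t(x, y)) - [\<phi>\<^sub>t x, \<phi>\<^sub>t y]\<close> and
  \<open>\<phi>\<^sub>t(g\<^sub>t(x, y, z)) - {\<phi>\<^sub>t x, \<phi>\<^sub>t y, \<phi>\<^sub>t z}\<close> vanish below degree \<open>n\<close>, with coefficients \<open>d, e\<close> in
  degree \<open>n\<close>.  Applying \<open>\<phi>\<^sub>t\<close> to the axioms LY5 and LY6 of the deformation and reading off the
  coefficient of \<open>t\<^sup>n\<close> shows that \<open>(d, e)\<close> is a cocycle, hence \<open>(\<delta>\<^sub>I h, \<delta>\<^sub>I\<^sub>I h)\<close> for some linear
  \<open>h\<close>.  Replacing \<open>\<phi>\<^sub>n\<close> by \<open>\<phi>\<^sub>n + h\<close> does not change the lower degrees and kills degree \<open>n\<close>.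
\<close>

section \<open>Sums over compositions of a degree\<close>

lemma finite_compositions:
  "finite {(i::nat, j). i + j = n}"
  "finite {(i::nat, j, k). i + j + k = n}"
  "finite {(i::nat, j, k, l). i + j + k + l = n}"
proof -
  show "finite {(i::nat, j). i + j = n}"
    by (rule finite_subset[of _ "{..n} \<times> {..n}"]) auto
  show "finite {(i::nat, j, k). i + j + k = n}"
    by (rule finite_subset[of _ "{..n} \<times> {..n} \<times> {..n}"]) auto
  show "finite {(i::nat, j, k, l). i + j + k + l = n}"
    by (rule finite_subset[of _ "{..n} \<times> {..n} \<times> {..n} \<times> {..n}"]) auto
qed

text \<open>The index sets take this projection form once \<open>split_def\<close> has been
  unfolded; the finiteness side conditions of \<open>sum.Sigma\<close> and \<open>sum_single\<close>
  then appear in it.\<close>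

lemmas finite_compositions' = finite_compositions[unfolded split_def]

lemma sum_compositions_2_swap:
  "(\<Sum>(i::nat, j)\<in>{(i, j). i + j = n}. F j i) = (\<Sum>(i, j)\<in>{(i, j). i + j = n}. F i j)"
  by (rule sum.reindex_bij_witness[where i = prod.swap and j = prod.swap]) auto

lemma sum_compositions_3_swap:
  "(\<Sum>(i::nat, j, k)\<in>{(i, j, k). i + j + k = n}. F j i k) =
    (\<Sum>(i, j, k)\<in>{(i, j, k). i + j + k = n}. F i j k)"
  by (rule sum.reindex_bij_witness
      [where i = "\<lambda>(i, j, k). (j, i, k)" and j = "\<lambda>(i, j, k). (j, i, k)"]) auto

text \<open>Only the summands with \<open>i = 0\<close> survive, so the triples collapse to
  pairs.\<close>

lemma fps_ext2_const_series_nth: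
  "fps_nth (fps_ext2 (const_series b) X Y) n =
    (\<Sum>(j, k)\<in>{(j, k). j + k = n}. b (fps_nth X j) (fps_nth Y k))"
proof -
  have "fps_nth (fps_ext2 (const_series b) X Y) n =
      (\<Sum>(i, j, k)\<in>(\<lambda>(j, k). (0, j, k)) ` {(j, k). j + k = n}.
        const_series b i (fps_nth X j) (fps_nth Y k))"
    unfolding fps_ext2_def fps_nth_Abs_fps
    by (rule sum.mono_neutral_right[OF finite_compositions(2)])
      (auto simp: const_series_def image_iff)
  then show ?thesis
    by (simp add: sum.reindex inj_on_def split_def const_series_def)
qed

lemma fps_ext3_const_series_nth:
  "fps_nth (fps_ext3 (const_series b) X Y Z) n =
    (\<Sum>(j, k, l)\<in>{(j, k, l). j + k + l = n}. b (fps_nth X j) (fps_nth Y k) (fps_nth Z l))"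
proof -
  have "fps_nth (fps_ext3 (const_series b) X Y Z) n =
      (\<Sum>(i, j, k, l)\<in>(\<lambda>(j, k, l). (0, j, k, l)) ` {(j, k, l). j + k + l = n}.
        const_series b i (fps_nth X j) (fps_nth Y k) (fps_nth Z l))"
    unfolding fps_ext3_def fps_nth_Abs_fps
    by (rule sum.mono_neutral_right[OF finite_compositions(3)])
      (auto simp: const_series_def image_iff)
  then show ?thesis
    by (simp add: sum.reindex inj_on_def split_def const_series_def)
qed

text \<open>As \<open>\<phi> 0 = id\<close>, coefficient \<open>n\<close> of the image is
  coefficient \<open>n\<close> of the argument plus a term in strictly lower coefficients. Such a
  unitriangular system is solved degree by degree.\<close>

lemma bij_fps_ext1:
  assumes "\<phi> 0 = id"
  shows "bij (fps_ext1 \<phi>)"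
proof (rule bijI)
  have nth: "fps_nth (fps_ext1 \<phi> X) n = fps_nth X n + (\<Sum>j<n. \<phi> (n - j) (fps_nth X j))" for X n
  proof -
    have "fps_nth (fps_ext1 \<phi> X) n = (\<Sum>j\<le>n. \<phi> (n - j) (fps_nth X j))"
      unfolding fps_ext1_def fps_nth_Abs_fps
      by (rule sum.reindex_bij_witness[where i = "\<lambda>j. (n - j, j)" and j = snd]) auto
    then show ?thesis
      by (simp add: assms add.commute flip: lessThan_Suc_atMost)
  qed
  show "inj (fps_ext1 \<phi>)"
  proof (rule injI)
    fix X Y assume eq: "fps_ext1 \<phi> X = fps_ext1 \<phi> Y"
    have "fps_nth X n = fps_nth Y n" for n
    proof (induction n rule: less_induct)
      case (less n)
      have "(\<Sum>j<n. \<phi> (n - j) (fps_nth X j)) = (\<Sum>j<n. \<phi> (n - j) (fps_nth Y j))"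
        by (rule sum.cong) (auto simp: less)
      then show ?case
        using arg_cong[OF eq, of "\<lambda>Z. fps_nth Z n"] by (simp add: nth)
    qed
    then show "X = Y" by (simp add: fps_eq_iff)
  qed
  show "surj (fps_ext1 \<phi>)"
    unfolding surj_def
  proof
    fix Y
    \<comment> \<open>Forward substitution: the recursive calls are at \<open>j < n\<close> only, so
      the \<open>cut\<close> introduced by \<open>wfrec\<close> has no effect.\<close>
    define x where "x = wfrec less_than (\<lambda>x n. fps_nth Y n - (\<Sum>j<n. \<phi> (n - j) (x j)))"
    have x: "x n + (\<Sum>j<n. \<phi> (n - j) (x j)) = fps_nth Y n" for n
      unfolding x_def by (subst wfrec) (auto simp: cut_def)
    have "Y = fps_ext1 \<phi> (Abs_fps x)" by (simp add: fps_eq_iff nth x)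
    then show "\<exists>X. Y = fps_ext1 \<phi> X" ..
  qed
qed

section \<open>The defect of a formal linear map\<close>

text \<open>
  The coefficients of the failure of \<open>\<phi>\<^sub>t\<close> to intertwine \<open>(f\<^sub>t, g\<^sub>t)\<close> with the null deformation.
\<close>

definition defect2 ::
    "('v \<Rightarrow> 'v \<Rightarrow> 'v::ab_group_add) \<Rightarrow> (nat \<Rightarrow> 'v \<Rightarrow> 'v \<Rightarrow> 'v) \<Rightarrow> (nat \<Rightarrow> 'v \<Rightarrow> 'v) \<Rightarrow>
     nat \<Rightarrow> 'v \<Rightarrow> 'v \<Rightarrow> 'v" where
  "defect2 br f \<phi> n x y = (\<Sum>(i, j)\<in>{(i, j). i + j = n}. \<phi> i (f j x y)) -
     (\<Sum>(i, j)\<in>{(i, j). i + j = n}. br (\<phi> i x) (\<phi> j y))"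

definition defect3 ::
    "('v \<Rightarrow> 'v \<Rightarrow> 'v \<Rightarrow> 'v::ab_group_add) \<Rightarrow> (nat \<Rightarrow> 'v \<Rightarrow> 'v \<Rightarrow> 'v \<Rightarrow> 'v) \<Rightarrow> (nat \<Rightarrow> 'v \<Rightarrow> 'v) \<Rightarrow>
     nat \<Rightarrow> 'v \<Rightarrow> 'v \<Rightarrow> 'v \<Rightarrow> 'v" where
  "defect3 tr g \<phi> n x y z = (\<Sum>(i, j)\<in>{(i, j). i + j = n}. \<phi> i (g j x y z)) -
     (\<Sum>(i, j, k)\<in>{(i, j, k). i + j + k = n}. tr (\<phi> i x) (\<phi> j y) (\<phi> k z))"

lemma bilinear_op_sum:
  assumes "bilinear_op scale b"
  shows "b (sum F A) y = (\<Sum>i\<in>A. b (F i) y)" "b x (sum F A) = (\<Sum>i\<in>A. b x (F i))"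
  using assms module_hom.sum unfolding bilinear_op_def by fast+

lemma trilinear_op_sum:
  assumes "trilinear_op scale b"
  shows "b (sum F A) y z = (\<Sum>i\<in>A. b (F i) y z)" "b x (sum F A) z = (\<Sum>i\<in>A. b x (F i) z)"
    "b x y (sum F A) = (\<Sum>i\<in>A. b x y (F i))"
  using assms module_hom.sum unfolding trilinear_op_def by fast+

text \<open>Both ways of combining \<open>\<phi>\<close> with a bracket extend series of bilinear
  maps on L, so their difference extends the difference of those series, which is the defect.
  Concretely, the terms are grouped by the degrees \<open>b\<close>, \<open>c\<close> taken from
  \<open>X\<close>, \<open>Y\<close>; the rest \<open>p\<close> is split between
  \<open>\<phi>\<close> and \<open>f\<close>, or between the two copies of
  \<open>\<phi>\<close>.\<close>

lemma fps_ext1_fps_ext2: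
  assumes "\<And>i. module_hom scale scale (\<phi> i)" and "bilinear_op scale br"
  shows "fps_ext1 \<phi> (fps_ext2 f X Y) =
    fps_ext2 (const_series br) (fps_ext1 \<phi> X) (fps_ext1 \<phi> Y) + fps_ext2 (defect2 br f \<phi>) X Y"
proof (rule fps_ext)
  fix n
  have "fps_nth (fps_ext1 \<phi> (fps_ext2 f X Y)) n =
      (\<Sum>(p, b, c)\<in>{(p, b, c). p + b + c = n}.
        \<Sum>(i, a)\<in>{(i, a). i + a = p}. \<phi> i (f a (fps_nth X b) (fps_nth Y c)))"
    unfolding fps_ext1_def fps_ext2_def fps_nth_Abs_fps split_def module_hom.sum[OF assms(1)]
    apply (subst (1 2) sum.Sigma; (intro ballI finite_compositions')?)
    apply (rule sum.reindex_bij_witness[where i = "\<lambda>((p, b, c), i, a). ((i, a + b + c), a, b, c)"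
          and j = "\<lambda>((i, m), a, b, c). ((i + a, b, c), i, a)"])
    by auto
  moreover have "fps_nth (fps_ext2 (const_series br) (fps_ext1 \<phi> X) (fps_ext1 \<phi> Y)) n =
      (\<Sum>(p, b, c)\<in>{(p, b, c). p + b + c = n}.
        \<Sum>(i, a)\<in>{(i, a). i + a = p}. br (\<phi> i (fps_nth X b)) (\<phi> a (fps_nth Y c)))"
    unfolding fps_ext2_const_series_nth fps_ext1_def fps_nth_Abs_fps split_def bilinear_op_sum[OF assms(2)]
      sum.cartesian_product
    apply (subst (1 2) sum.Sigma; (intro ballI finite_compositions' finite_cartesian_product)?)
    \<comment> \<open>The outer pair of total degrees in \<open>X\<close> and \<open>Y\<close> is
      determined by the inner pairs, which appear with the one for \<open>Y\<close> first.\<close>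
    apply (rule sum.reindex_bij_witness[where i = "\<lambda>((p, b, c), i, a). ((i + b, a + c), (a, c), (i, b))"
          and j = "\<lambda>(_, (a, c), (i, b)). ((i + a, b, c), i, a)"])
    by auto
  ultimately show "fps_nth (fps_ext1 \<phi> (fps_ext2 f X Y)) n =
      fps_nth (fps_ext2 (const_series br) (fps_ext1 \<phi> X) (fps_ext1 \<phi> Y) +
        fps_ext2 (defect2 br f \<phi>) X Y) n"
    by (simp add: fps_ext2_def[of "defect2 br f \<phi>"] defect2_def split_def sum_subtractf)
qed

lemma fps_ext1_fps_ext3:
  assumes "\<And>i. module_hom scale scale (\<phi> i)" and "trilinear_op scale tr"
  shows "fps_ext1 \<phi> (fps_ext3 g X Y Z) =
    fps_ext3 (const_series tr) (fps_ext1 \<phi> X) (fps_ext1 \<phi> Y) (fps_ext1 \<phi> Z) +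
      fps_ext3 (defect3 tr g \<phi>) X Y Z"
proof (rule fps_ext)
  fix n
  have "fps_nth (fps_ext1 \<phi> (fps_ext3 g X Y Z)) n =
      (\<Sum>(p, b, c, d)\<in>{(p, b, c, d). p + b + c + d = n}.
        \<Sum>(i, a)\<in>{(i, a). i + a = p}. \<phi> i (g a (fps_nth X b) (fps_nth Y c) (fps_nth Z d)))"
    unfolding fps_ext1_def fps_ext3_def fps_nth_Abs_fps split_def module_hom.sum[OF assms(1)]
    apply (subst (1 2) sum.Sigma; (intro ballI finite_compositions')?)
    apply (rule sum.reindex_bij_witness[where i = "\<lambda>((p, b, c, d), i, a). ((i, a + b + c + d), a, b, c, d)"
          and j = "\<lambda>((i, m), a, b, c, d). ((i + a, b, c, d), i, a)"])
    by auto
  moreover have "fps_nth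
        (fps_ext3 (const_series tr) (fps_ext1 \<phi> X) (fps_ext1 \<phi> Y) (fps_ext1 \<phi> Z)) n =
      (\<Sum>(p, b, c, d)\<in>{(p, b, c, d). p + b + c + d = n}.
        \<Sum>(i, j, k)\<in>{(i, j, k). i + j + k = p}.
          tr (\<phi> i (fps_nth X b)) (\<phi> j (fps_nth Y c)) (\<phi> k (fps_nth Z d)))"
    unfolding fps_ext3_const_series_nth fps_ext1_def fps_nth_Abs_fps split_def trilinear_op_sum[OF assms(2)]
      sum.cartesian_product
    apply (subst (1 2) sum.Sigma; (intro ballI finite_compositions' finite_cartesian_product)?)
    apply (rule sum.reindex_bij_witness
        [where i = "\<lambda>((p, b, c, d), i, j, k). ((i + b, j + c, k + d), (k, d), (j, c), (i, b))"
          and j = "\<lambda>(_, (k, d), (j, c), (i, b)). ((i + j + k, b, c, d), i, j, k)"])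
    by auto
  ultimately show "fps_nth (fps_ext1 \<phi> (fps_ext3 g X Y Z)) n =
      fps_nth (fps_ext3 (const_series tr) (fps_ext1 \<phi> X) (fps_ext1 \<phi> Y) (fps_ext1 \<phi> Z) +
        fps_ext3 (defect3 tr g \<phi>) X Y Z) n"
    by (simp add: fps_ext3_def[of "defect3 tr g \<phi>"] defect3_def split_def sum_subtractf)
qed

lemma fps_ext1_module_hom:
  assumes "module scale" and "\<And>i. module_hom scale scale (\<phi> i)"
  shows "module_hom (fps_scale scale) (fps_scale scale) (fps_ext1 \<phi>)"
proof -
  have "fps_ext1 \<phi> (X + Y) = fps_ext1 \<phi> X + fps_ext1 \<phi> Y" for X Y
    by (simp add: fps_eq_iff fps_ext1_def module_hom.add[OF assms(2)] split_def sum.distrib)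
  moreover have "fps_ext1 \<phi> (fps_scale scale c X) = fps_scale scale c (fps_ext1 \<phi> X)" for c X
    unfolding fps_ext1_def fps_scale_def fps_nth_Abs_fps
      module_hom.sum[OF assms(2)] module.scale_sum_right[OF assms(1)] split_def module_hom.scale[OF assms(2)]
    apply (rule fps_ext, unfold fps_nth_Abs_fps)
    apply (subst (1 2) sum.Sigma; (intro ballI finite_compositions' finite_atMost)?)
    \<comment> \<open>Here \<open>a\<close> is the degree taken from the scalar series and
      \<open>m = a + b\<close> the degree reached after scaling.\<close>
    apply (rule sum.reindex_bij_witness[where i = "\<lambda>(a, i, b). ((i, a + b), a)"
          and j = "\<lambda>((i, m), a). (a, i, m - a)"])
    by auto
  ultimately show ?thesis
    by (simp add: module_hom_iff module_fps_scale assms(1))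
qed


section \<open>Flattening the nested products of LY5 and LY6\<close>

text \<open>With \<open>a, b, c, d\<close> the degrees in x, y, u, v, these are the nestings
  [{x,y,u},v] and [u,{x,y,v}] from LY5. The common index set on the right lets LY5 be applied
  summand by summand.\<close>

lemma sum_nested_compositions_2_3:
  "(\<Sum>(j::nat, d)\<in>{(j, d). j + d = n}. \<Sum>(a, b, c)\<in>{(a, b, c). a + b + c = j}. F a b c d) =
    (\<Sum>(a, b, c, d)\<in>{(a, b, c, d). a + b + c + d = n}. F a b c d)"
  "(\<Sum>(c::nat, k)\<in>{(c, k). c + k = n}. \<Sum>(a, b, d)\<in>{(a, b, d). a + b + d = k}. F a b c d) =
    (\<Sum>(a, b, c, d)\<in>{(a, b, c, d). a + b + c + d = n}. F a b c d)"
  unfolding split_def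
  apply (subst sum.Sigma; (intro ballI finite_compositions')?)
  apply (rule sum.reindex_bij_witness[where i = "\<lambda>(a, b, c, d). ((a + b + c, d), a, b, c)"
        and j = "\<lambda>((j, d), a, b, c). (a, b, c, d)"]; auto)
  apply (subst sum.Sigma; (intro ballI finite_compositions')?)
  apply (rule sum.reindex_bij_witness[where i = "\<lambda>(a, b, c, d). ((c, a + b + d), a, b, d)"
        and j = "\<lambda>((c, k), a, b, d). (a, b, c, d)"]; auto)
  done

text \<open>The remaining nesting {x,y,[u,v]} from LY5.\<close>

lemma sum_nested_compositions_3_2:
  "(\<Sum>(a::nat, b, l)\<in>{(a, b, l). a + b + l = n}. \<Sum>(c, d)\<in>{(c, d). c + d = l}. F a b c d) =
    (\<Sum>(a, b, c, d)\<in>{(a, b, c, d). a + b + c + d = n}. F a b c d)"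
  unfolding split_def
  apply (subst sum.Sigma; (intro ballI finite_compositions')?)
  apply (rule sum.reindex_bij_witness[where i = "\<lambda>(a, b, c, d). ((a, b, c + d), c, d)"
        and j = "\<lambda>((a, b, l), c, d). (a, b, c, d)"]; auto)
  done

text \<open>The four nestings of LY6, with \<open>a, b, c, d, e\<close> the degrees in x, y, u, v,
  w: {{x,y,u},v,w}, {u,{x,y,v},w}, {u,v,{x,y,w}} and {x,y,{u,v,w}}.\<close>

lemma sum_nested_compositions_3_3:
  "(\<Sum>(j::nat, d, e)\<in>{(j, d, e). j + d + e = n}.
      \<Sum>(a, b, c)\<in>{(a, b, c). a + b + c = j}. F a b c d e) =
    (\<Sum>(a, b, c, d, e)\<in>{(a, b, c, d, e). a + b + c + d + e = n}. F a b c d e)"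
  "(\<Sum>(c::nat, k, e)\<in>{(c, k, e). c + k + e = n}.
      \<Sum>(a, b, d)\<in>{(a, b, d). a + b + d = k}. F a b c d e) =
    (\<Sum>(a, b, c, d, e)\<in>{(a, b, c, d, e). a + b + c + d + e = n}. F a b c d e)"
  "(\<Sum>(c::nat, d, l)\<in>{(c, d, l). c + d + l = n}.
      \<Sum>(a, b, e)\<in>{(a, b, e). a + b + e = l}. F a b c d e) =
    (\<Sum>(a, b, c, d, e)\<in>{(a, b, c, d, e). a + b + c + d + e = n}. F a b c d e)"
  "(\<Sum>(a::nat, b, l)\<in>{(a, b, l). a + b + l = n}.
      \<Sum>(c, d, e)\<in>{(c, d, e). c + d + e = l}. F a b c d e) =
    (\<Sum>(a, b, c, d, e)\<in>{(a, b, c, d, e). a + b + c + d + e = n}. F a b c d e)"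
  unfolding split_def
  apply (subst sum.Sigma; (intro ballI finite_compositions')?)
  apply (rule sum.reindex_bij_witness[where i = "\<lambda>(a, b, c, d, e). ((a + b + c, d, e), a, b, c)"
        and j = "\<lambda>((j, d, e), a, b, c). (a, b, c, d, e)"]; auto)
  apply (subst sum.Sigma; (intro ballI finite_compositions')?)
  apply (rule sum.reindex_bij_witness[where i = "\<lambda>(a, b, c, d, e). ((c, a + b + d, e), a, b, d)"
        and j = "\<lambda>((c, k, e), a, b, d). (a, b, c, d, e)"]; auto)
  apply (subst sum.Sigma; (intro ballI finite_compositions')?)
  apply (rule sum.reindex_bij_witness[where i = "\<lambda>(a, b, c, d, e). ((c, d, a + b + e), a, b, e)"
        and j = "\<lambda>((c, d, l), a, b, e). (a, b, c, d, e)"]; auto)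
  apply (subst sum.Sigma; (intro ballI finite_compositions')?)
  apply (rule sum.reindex_bij_witness[where i = "\<lambda>(a, b, c, d, e). ((a, b, c + d + e), c, d, e)"
        and j = "\<lambda>((a, b, l), c, d, e). (a, b, c, d, e)"]; auto)
  done

lemma sum_single:
  assumes "finite S" "s \<in> S" "\<And>p. p \<in> S \<Longrightarrow> p \<noteq> s \<Longrightarrow> F p = 0"
  shows "sum F S = F s"
  using sum.mono_neutral_right[of S "{s}" F] assms by auto

text \<open>When \<open>d\<close> already uses up degree \<open>n\<close>, no degree is left for the
  arguments, so the leading coefficient sees only their constant terms.\<close>

lemma fps_ext2_nth_lowest:
  assumes "\<And>k. k < n \<Longrightarrow> d k = 0"
  shows "k < n \<Longrightarrow> fps_nth (fps_ext2 d X Y) k = 0"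
    and "fps_nth (fps_ext2 d X Y) n = d n (fps_nth X 0) (fps_nth Y 0)"
proof -
  show "fps_nth (fps_ext2 d X Y) k = 0" if "k < n"
    using that assms by (auto simp: fps_ext2_def intro!: sum.neutral)
  show "fps_nth (fps_ext2 d X Y) n = d n (fps_nth X 0) (fps_nth Y 0)"
    unfolding fps_ext2_def fps_nth_Abs_fps
  proof (subst sum_single[of _ "(n, 0, 0)"])
    show "(case p of (i, j, k) \<Rightarrow> d i (fps_nth X j) (fps_nth Y k)) = 0"
      if "p \<in> {(i, j, k). i + j + k = n}" "p \<noteq> (n, 0, 0)" for p
      using that assms[of "fst p"] by (cases p) auto
  qed (auto simp: finite_compositions)
qed

lemma fps_ext3_nth_lowest:
  assumes "\<And>k. k < n \<Longrightarrow> e k = 0"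
  shows "k < n \<Longrightarrow> fps_nth (fps_ext3 e X Y Z) k = 0"
    and "fps_nth (fps_ext3 e X Y Z) n = e n (fps_nth X 0) (fps_nth Y 0) (fps_nth Z 0)"
proof -
  show "fps_nth (fps_ext3 e X Y Z) k = 0" if "k < n"
    using that assms by (auto simp: fps_ext3_def intro!: sum.neutral)
  show "fps_nth (fps_ext3 e X Y Z) n = e n (fps_nth X 0) (fps_nth Y 0) (fps_nth Z 0)"
    unfolding fps_ext3_def fps_nth_Abs_fps
  proof (subst sum_single[of _ "(n, 0, 0, 0)"])
    show "(case p of (i, j, k, l) \<Rightarrow> e i (fps_nth X j) (fps_nth Y k) (fps_nth Z l)) = 0"
      if "p \<in> {(i, j, k, l). i + j + k + l = n}" "p \<noteq> (n, 0, 0, 0)" for p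
      using that assms[of "fst p"] by (cases p) auto
  qed (auto simp: finite_compositions)
qed

text \<open>Lets a correction in degree \<open>n\<close> leave the lower defects alone, and later
  lets the limit of the construction inherit the defects of its stages.\<close>

lemma defect_cong:
  assumes "\<And>i. i \<le> n \<Longrightarrow> \<phi> i = \<psi> i"
  shows "defect2 br f \<phi> n = defect2 br f \<psi> n" and "defect3 tr g \<phi> n = defect3 tr g \<psi> n"
proof -
  show "defect2 br f \<phi> n = defect2 br f \<psi> n"
    unfolding defect2_def fun_eq_iff
    by (intro allI arg_cong2[where f = "(-)"] sum.cong) (auto simp: assms)
  show "defect3 tr g \<phi> n = defect3 tr g \<psi> n"
    unfolding defect3_def fun_eq_iff
    by (intro allI arg_cong2[where f = "(-)"] sum.cong) (auto simp: assms)
qed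

section \<open>The operations of the null deformation on L[[t]]\<close>

context lie_yamaguti
begin

abbreviation (input) "br_t \<equiv> fps_ext2 (const_series br)"
abbreviation (input) "tr_t \<equiv> fps_ext3 (const_series tr)"

lemma br_t_add:
  "br_t (X + Y) Z = br_t X Z + br_t Y Z" "br_t X (Y + Z) = br_t X Y + br_t X Z"
  by (simp_all add: fps_eq_iff fps_ext2_const_series_nth multilinear_simps split_def sum.distrib)

lemma tr_t_add:
  "tr_t (X + Y) Z W = tr_t X Z W + tr_t Y Z W" "tr_t X (Y + Z) W = tr_t X Y W + tr_t X Z W"
  "tr_t X Y (Z + W) = tr_t X Y Z + tr_t X Y W"
  by (simp_all add: fps_eq_iff fps_ext3_const_series_nth multilinear_simps split_def sum.distrib)

lemma br_t_swap: "br_t X Y = - br_t Y X"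
proof (rule fps_ext)
  fix n
  show "fps_nth (br_t X Y) n = fps_nth (- br_t Y X) n"
    \<comment> \<open>LY1 is used only with a coefficient of \<open>X\<close> in front, which keeps
      the rewriting from looping.\<close>
    by (simp add: fps_ext2_const_series_nth LY1[of "fps_nth X i" for i] sum_negf split_def
        sum_compositions_2_swap[of "\<lambda>j i. br (fps_nth Y j) (fps_nth X i)", unfolded split_def])
qed

lemma tr_t_swap: "tr_t X Y Z = - tr_t Y X Z"
proof (rule fps_ext)
  fix n
  show "fps_nth (tr_t X Y Z) n = fps_nth (- tr_t Y X Z) n"
    by (simp add: fps_ext3_const_series_nth LY2[of "fps_nth X i" for i] sum_negf split_def
        sum_compositions_3_swap[of "\<lambda>j i k. tr (fps_nth Y j) (fps_nth X i) (fps_nth Z k)",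
          unfolded split_def])
qed

lemma tr_t_br_t: "tr_t X Y (br_t U V) = br_t (tr_t X Y U) V + br_t U (tr_t X Y V)"
proof (rule fps_ext)
  fix n
  note sums = bilinear_op_sum[OF bilinear] trilinear_op_sum[OF trilinear]
  let ?x = "fps_nth X" and ?y = "fps_nth Y" and ?u = "fps_nth U" and ?v = "fps_nth V"
  have "fps_nth (tr_t X Y (br_t U V)) n =
      (\<Sum>(a, b, c, d)\<in>{(a, b, c, d). a + b + c + d = n}. tr (?x a) (?y b) (br (?u c) (?v d)))"
    unfolding sum_nested_compositions_3_2[symmetric]
    by (simp add: fps_ext3_const_series_nth fps_ext2_const_series_nth sums split_def)
  moreover have "fps_nth (br_t (tr_t X Y U) V) n =
      (\<Sum>(a, b, c, d)\<in>{(a, b, c, d). a + b + c + d = n}. br (tr (?x a) (?y b) (?u c)) (?v d))"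
    unfolding sum_nested_compositions_2_3(1)[symmetric]
    by (simp add: fps_ext3_const_series_nth fps_ext2_const_series_nth sums split_def)
  moreover have "fps_nth (br_t U (tr_t X Y V)) n =
      (\<Sum>(a, b, c, d)\<in>{(a, b, c, d). a + b + c + d = n}. br (?u c) (tr (?x a) (?y b) (?v d)))"
    unfolding sum_nested_compositions_2_3(2)[symmetric]
    by (simp add: fps_ext3_const_series_nth fps_ext2_const_series_nth sums split_def)
  ultimately show "fps_nth (tr_t X Y (br_t U V)) n =
      fps_nth (br_t (tr_t X Y U) V + br_t U (tr_t X Y V)) n"
    by (simp add: LY5 sum.distrib split_def)
qed

lemma tr_t_tr_t: "tr_t X Y (tr_t U V W) =
  tr_t (tr_t X Y U) V W + tr_t U (tr_t X Y V) W + tr_t U V (tr_t X Y W)"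
proof (rule fps_ext)
  fix n :: nat
  note sums = trilinear_op_sum[OF trilinear]
  let ?x = "fps_nth X" and ?y = "fps_nth Y" and ?u = "fps_nth U" and ?v = "fps_nth V"
    and ?w = "fps_nth W"
  let ?S = "{(a, b, c, d, e). a + b + c + d + e = n}"
  have "fps_nth (tr_t X Y (tr_t U V W)) n =
      (\<Sum>(a, b, c, d, e)\<in>?S. tr (?x a) (?y b) (tr (?u c) (?v d) (?w e)))"
    unfolding sum_nested_compositions_3_3(4)[symmetric]
    by (simp add: fps_ext3_const_series_nth sums split_def)
  moreover have "fps_nth (tr_t (tr_t X Y U) V W) n =
      (\<Sum>(a, b, c, d, e)\<in>?S. tr (tr (?x a) (?y b) (?u c)) (?v d) (?w e))"
    unfolding sum_nested_compositions_3_3(1)[symmetric]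
    by (simp add: fps_ext3_const_series_nth sums split_def)
  moreover have "fps_nth (tr_t U (tr_t X Y V) W) n =
      (\<Sum>(a, b, c, d, e)\<in>?S. tr (?u c) (tr (?x a) (?y b) (?v d)) (?w e))"
    unfolding sum_nested_compositions_3_3(2)[symmetric]
    by (simp add: fps_ext3_const_series_nth sums split_def)
  moreover have "fps_nth (tr_t U V (tr_t X Y W)) n =
      (\<Sum>(a, b, c, d, e)\<in>?S. tr (?u c) (?v d) (tr (?x a) (?y b) (?w e)))"
    unfolding sum_nested_compositions_3_3(3)[symmetric]
    by (simp add: fps_ext3_const_series_nth sums split_def)
  ultimately show "fps_nth (tr_t X Y (tr_t U V W)) n = fps_nth
      (tr_t (tr_t X Y U) V W + tr_t U (tr_t X Y V) W + tr_t U V (tr_t X Y W)) n"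
    \<comment> \<open>Only products with \<open>X\<close> and \<open>Y\<close> outermost are
      expanded; unrestricted, LY6 would also expand {u,v,{x,y,w}} on its own right-hand
      side.\<close>
    by (simp add: LY6[of "?x a" "?y b" for a b] sum.distrib split_def)
qed

lemma br_t_nth_lowest:
  assumes "\<And>k. k < n \<Longrightarrow> fps_nth X k = 0"
  shows "fps_nth (br_t X Y) n = br (fps_nth X n) (fps_nth Y 0)"
    and "fps_nth (br_t Y X) n = br (fps_nth Y 0) (fps_nth X n)"
proof -
  show "fps_nth (br_t X Y) n = br (fps_nth X n) (fps_nth Y 0)"
    unfolding fps_ext2_const_series_nth
  proof (subst sum_single[of _ "(n, 0)"])
    show "(case p of (j, k) \<Rightarrow> br (fps_nth X j) (fps_nth Y k)) = 0"
      if "p \<in> {(j, k). j + k = n}" "p \<noteq> (n, 0)" for p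
      using that assms[of "fst p"] by (cases p) (auto simp: br_hom[THEN module_hom.zero])
  qed (auto simp: finite_compositions)
  then show "fps_nth (br_t Y X) n = br (fps_nth Y 0) (fps_nth X n)"
    using br_t_swap[of Y X] LY1[of "fps_nth Y 0" "fps_nth X n"] by simp
qed

lemma tr_t_nth_lowest:
  assumes "\<And>k. k < n \<Longrightarrow> fps_nth X k = 0"
  shows "fps_nth (tr_t X Y Z) n = tr (fps_nth X n) (fps_nth Y 0) (fps_nth Z 0)"
    and "fps_nth (tr_t Y X Z) n = tr (fps_nth Y 0) (fps_nth X n) (fps_nth Z 0)"
    and "fps_nth (tr_t Y Z X) n = tr (fps_nth Y 0) (fps_nth Z 0) (fps_nth X n)"
proof -
  show "fps_nth (tr_t X Y Z) n = tr (fps_nth X n) (fps_nth Y 0) (fps_nth Z 0)"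
    unfolding fps_ext3_const_series_nth
  proof (subst sum_single[of _ "(n, 0, 0)"])
    show "(case p of (j, k, l) \<Rightarrow> tr (fps_nth X j) (fps_nth Y k) (fps_nth Z l)) = 0"
      if "p \<in> {(j, k, l). j + k + l = n}" "p \<noteq> (n, 0, 0)" for p
      using that assms[of "fst p"] by (cases p) (auto simp: tr_hom[THEN module_hom.zero])
  qed (auto simp: finite_compositions)
  then show "fps_nth (tr_t Y X Z) n = tr (fps_nth Y 0) (fps_nth X n) (fps_nth Z 0)"
    using tr_t_swap[of Y X Z] LY2[of "fps_nth Y 0" "fps_nth X n" "fps_nth Z 0"] by simp
  show "fps_nth (tr_t Y Z X) n = tr (fps_nth Y 0) (fps_nth Z 0) (fps_nth X n)"
    unfolding fps_ext3_const_series_nth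
  proof (subst sum_single[of _ "(0, 0, n)"])
    show "(case p of (j, k, l) \<Rightarrow> tr (fps_nth Y j) (fps_nth Z k) (fps_nth X l)) = 0"
      if "p \<in> {(j, k, l). j + k + l = n}" "p \<noteq> (0, 0, n)" for p
      using that assms[of "snd (snd p)"] by (cases p) (auto simp: tr_hom[THEN module_hom.zero])
  qed (auto simp: finite_compositions)
qed

section \<open>Linearity of the defect and its change under a correction of
  \<open>\<phi>\<close>\<close>

lemma bilinear_op_defect2:
  assumes "\<And>i. module_hom scale scale (\<phi> i)" and "\<And>i. bilinear_op scale (f i)"
  shows "bilinear_op scale (defect2 br f \<phi> n)"
  using assms bilinear
  by (simp add: bilinear_op_def module_hom_iff defect2_def split_def sum.distrib
      scale_right_diff_distrib scale_sum_right)

lemma trilinear_op_defect3: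
  assumes "\<And>i. module_hom scale scale (\<phi> i)" and "\<And>i. trilinear_op scale (g i)"
  shows "trilinear_op scale (defect3 tr g \<phi> n)"
  using assms trilinear
  by (simp add: trilinear_op_def module_hom_iff defect3_def split_def sum.distrib
      scale_right_diff_distrib scale_sum_right)

text \<open>In degree \<open>n\<close> the coefficient \<open>\<phi> n\<close> occurs only next to
  index 0, where \<open>\<phi> 0 = id\<close> and \<open>f 0 = br\<close>. The change is thus h[x,y]
  - [h x,y] - [x,h y], the negative of the coboundary of \<open>h\<close>.\<close>

lemma defect2_update:
  assumes "n > 0" and "\<phi> 0 = id" and "f 0 = br"
  shows "defect2 br f (\<phi>(n := \<lambda>x. \<phi> n x + h x)) n x y = defect2 br f \<phi> n x y - delta1_I br h x y"
proof -
  let ?\<psi> = "\<phi>(n := \<lambda>x. \<phi> n x + h x)" and ?S = "{(i, j). i + j = n}"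
  have "(\<Sum>(i, j)\<in>?S. ?\<psi> i (f j x y)) =
      (\<Sum>(i, j)\<in>?S. \<phi> i (f j x y) + (if (i, j) = (n, 0) then h (f j x y) else 0))"
    by (rule sum.cong) auto
  also have "\<dots> = (\<Sum>(i, j)\<in>?S. \<phi> i (f j x y)) + h (br x y)"
    unfolding split_def sum.distrib
    by (subst (2) sum_single[of _ "(n, 0)"]) (auto simp: finite_compositions' assms)
  finally have 1: "(\<Sum>(i, j)\<in>?S. ?\<psi> i (f j x y)) = (\<Sum>(i, j)\<in>?S. \<phi> i (f j x y)) + h (br x y)" .
  \<comment> \<open>As \<open>n > 0\<close>, the pairs \<open>(n, 0)\<close> and
    \<open>(0, n)\<close> differ and no term has \<open>h\<close> in both slots.\<close>
  have "(\<Sum>(i, j)\<in>?S. br (?\<psi> i x) (?\<psi> j y)) =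
      (\<Sum>(i, j)\<in>?S. br (\<phi> i x) (\<phi> j y) + ((if (i, j) = (n, 0) then br (h x) (\<phi> j y) else 0) +
        (if (i, j) = (0, n) then br (\<phi> i x) (h y) else 0)))"
    using assms(1) by (intro sum.cong) (auto simp: multilinear_simps)
  also have "\<dots> = (\<Sum>(i, j)\<in>?S. br (\<phi> i x) (\<phi> j y)) + (br (h x) y + br x (h y))"
    unfolding split_def sum.distrib
    by (subst (2) sum_single[of _ "(n, 0)"], (auto simp: finite_compositions')[3],
        subst (2) sum_single[of _ "(0, n)"]) (auto simp: finite_compositions' assms)
  finally have 2: "(\<Sum>(i, j)\<in>?S. br (?\<psi> i x) (?\<psi> j y)) =
      (\<Sum>(i, j)\<in>?S. br (\<phi> i x) (\<phi> j y)) + (br (h x) y + br x (h y))" .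
  show ?thesis
    unfolding defect2_def 1 2 by (simp add: delta1_I_def LY1[of y "h x"])
qed

text \<open>As for the bracket, with three slots for \<open>h\<close>; LY2 turns {x,h y,z} into the
  form - {h y,x,z} used in \<open>delta1_II\<close>.\<close>

lemma defect3_update:
  assumes "n > 0" and "\<phi> 0 = id" and "g 0 = tr"
  shows "defect3 tr g (\<phi>(n := \<lambda>x. \<phi> n x + h x)) n x y z =
    defect3 tr g \<phi> n x y z - delta1_II tr h x y z"
proof -
  let ?\<psi> = "\<phi>(n := \<lambda>x. \<phi> n x + h x)" and ?S = "{(i, j). i + j = n}"
    and ?T = "{(i, j, k). i + j + k = n}"
  have "(\<Sum>(i, j)\<in>?S. ?\<psi> i (g j x y z)) =
      (\<Sum>(i, j)\<in>?S. \<phi> i (g j x y z) + (if (i, j) = (n, 0) then h (g j x y z) else 0))"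
    by (rule sum.cong) auto
  also have "\<dots> = (\<Sum>(i, j)\<in>?S. \<phi> i (g j x y z)) + h (tr x y z)"
    unfolding split_def sum.distrib
    by (subst (2) sum_single[of _ "(n, 0)"]) (auto simp: finite_compositions' assms)
  finally have 1: "(\<Sum>(i, j)\<in>?S. ?\<psi> i (g j x y z)) =
      (\<Sum>(i, j)\<in>?S. \<phi> i (g j x y z)) + h (tr x y z)" .
  have "(\<Sum>(i, j, k)\<in>?T. tr (?\<psi> i x) (?\<psi> j y) (?\<psi> k z)) =
      (\<Sum>(i, j, k)\<in>?T. tr (\<phi> i x) (\<phi> j y) (\<phi> k z) +
        ((if (i, j, k) = (n, 0, 0) then tr (h x) (\<phi> j y) (\<phi> k z) else 0) +
        ((if (i, j, k) = (0, n, 0) then tr (\<phi> i x) (h y) (\<phi> k z) else 0) +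
        (if (i, j, k) = (0, 0, n) then tr (\<phi> i x) (\<phi> j y) (h z) else 0))))"
    using assms(1) by (intro sum.cong) (auto simp: multilinear_simps)
  also have "\<dots> = (\<Sum>(i, j, k)\<in>?T. tr (\<phi> i x) (\<phi> j y) (\<phi> k z)) +
      (tr (h x) y z + (tr x (h y) z + tr x y (h z)))"
    unfolding split_def sum.distrib
    by (subst (2) sum_single[of _ "(n, 0, 0)"], (auto simp: finite_compositions')[3],
        subst (2) sum_single[of _ "(0, n, 0)"], (auto simp: finite_compositions')[3],
        subst (2) sum_single[of _ "(0, 0, n)"]) (auto simp: finite_compositions' assms)
  finally have 2: "(\<Sum>(i, j, k)\<in>?T. tr (?\<psi> i x) (?\<psi> j y) (?\<psi> k z)) =
      (\<Sum>(i, j, k)\<in>?T. tr (\<phi> i x) (\<phi> j y) (\<phi> k z)) + (tr (h x) y z + (tr x (h y) z + tr x y (h z)))" .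
  show ?thesis
    unfolding defect3_def 1 2 by (simp add: delta1_II_def LY2[of "h y" x] algebra_simps)
qed

section \<open>The lowest defect is a cocycle\<close>

text \<open>Moving \<open>\<phi>\<close> past one operation at a time yields correction terms
  \<open>D\<close>, \<open>E\<close> that enter linearly. The terms free of them cancel by LY5 and
  LY6 for the constant operations, leaving exact identities whose lowest coefficients are the
  cocycle equations.\<close>

lemma defect_in_Z23:
  assumes two: "\<And>x::'m. x + x = 0 \<Longrightarrow> x = 0"
    and deformation: "formal_deformation scale br tr f g"
    and hom: "\<And>i. module_hom scale scale (\<phi> i)" and "\<phi> 0 = id"
    and d0: "\<And>k. k < n \<Longrightarrow> defect2 br f \<phi> k = 0"
    and e0: "\<And>k. k < n \<Longrightarrow> defect3 tr g \<phi> k = 0"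
  shows "(defect2 br f \<phi> n, defect3 tr g \<phi> n) \<in> Z23 scale br tr"
proof -
  have fg: "f 0 = br" "g 0 = tr" "\<And>i. bilinear_op scale (f i)" "\<And>i. trilinear_op scale (g i)"
    and LY: "lie_yamaguti (fps_scale scale) (fps_ext2 f) (fps_ext3 g)"
    using deformation by (auto simp: formal_deformation_def)
  interpret t: lie_yamaguti "fps_scale scale" "fps_ext2 f" "fps_ext3 g" by (rule LY)
  define P where "P = fps_ext1 \<phi>"
  define d e where "d = defect2 br f \<phi>" and "e = defect3 tr g \<phi>"
  define D E where "D = fps_ext2 d" and "E = fps_ext3 e"
  interpret P: module_hom "fps_scale scale" "fps_scale scale" P
    unfolding P_def by (rule fps_ext1_module_hom[OF module_axioms hom])
  have PF: "P (fps_ext2 f X Y) = br_t (P X) (P Y) + D X Y" for X Y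
    unfolding P_def D_def d_def by (rule fps_ext1_fps_ext2[OF hom bilinear])
  have PG: "P (fps_ext3 g X Y Z) = tr_t (P X) (P Y) (P Z) + E X Y Z" for X Y Z
    unfolding P_def E_def e_def by (rule fps_ext1_fps_ext3[OF hom trilinear])
  \<comment> \<open>Absence of 2-torsion passes to L[[t]] coefficientwise and turns antisymmetry
    into vanishing on equal arguments.\<close>
  have two_t: "X = 0" if "X = - X" for X :: "'m fps"
    using two that by (metis eq_neg_iff_add_eq_0 fps_add_nth fps_ext fps_zero_nth)
  have P_nth_0: "fps_nth (P X) 0 = fps_nth X 0" for X
  proof -
    have "{(i, j). i + j = 0} = {(0::nat, 0::nat)}" by auto
    then show ?thesis by (simp add: P_def fps_ext1_def \<open>\<phi> 0 = id\<close>)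
  qed
  have F_nth_0: "fps_nth (fps_ext2 f X Y) 0 = br (fps_nth X 0) (fps_nth Y 0)" for X Y
    using fps_ext2_nth_lowest(2)[of 0 f] by (simp add: fg)
  have G_nth_0: "fps_nth (fps_ext3 g X Y Z) 0 = tr (fps_nth X 0) (fps_nth Y 0) (fps_nth Z 0)"
    for X Y Z
    using fps_ext3_nth_lowest(2)[of 0 g] by (simp add: fg)
  have D_nth: "\<And>k. k < n \<Longrightarrow> fps_nth (D X Y) k = 0"
    "fps_nth (D X Y) n = d n (fps_nth X 0) (fps_nth Y 0)" for X Y
    using fps_ext2_nth_lowest[of n d] d0 by (simp_all add: D_def d_def)
  have E_nth: "\<And>k. k < n \<Longrightarrow> fps_nth (E X Y Z) k = 0"
    "fps_nth (E X Y Z) n = e n (fps_nth X 0) (fps_nth Y 0) (fps_nth Z 0)" for X Y Z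
    using fps_ext3_nth_lowest[of n e] e0 by (simp_all add: E_def e_def)
  note nth_simps = D_nth E_nth P_nth_0 F_nth_0 G_nth_0 br_t_nth_lowest tr_t_nth_lowest

  \<comment> \<open>\<open>D\<close> is a difference of two alternating operations; evaluating at
    constant series transfers this to \<open>d n\<close>.\<close>
  have "D X X = 0" for X
    using PF[of X X] two_t[OF t.LY1, of X] two_t[OF br_t_swap, of "P X"] by simp
  then have "d n x x = 0" for x
    using D_nth(2)[of "fps_const x" "fps_const x"] by simp
  then have C2: "d n \<in> C2 scale"
    using bilinear_op_defect2[OF hom fg(3)] by (simp add: C2_def d_def)
  have "E X X Y = 0" for X Y
    using PG[of X X Y] two_t[OF t.LY2, of X Y] two_t[OF tr_t_swap, of "P X" "P Y"] by simp
  then have "e n x x y = 0" for x y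
    using E_nth(2)[of "fps_const x" "fps_const x" "fps_const y"] by simp
  then have C3: "e n \<in> C3 scale"
    using trilinear_op_defect3[OF hom fg(4)] by (simp add: C3_def e_def)

  have "tr_t (P X) (P Y) (D U V) + E X Y (fps_ext2 f U V) =
      br_t (E X Y U) (P V) + D (fps_ext3 g X Y U) V + br_t (P U) (E X Y V) + D U (fps_ext3 g X Y V)"
    for X Y U V
    using arg_cong[OF t.LY5[of X Y U V], of P]
    by (simp add: P.add PF PG br_t_add tr_t_add tr_t_br_t algebra_simps)
  \<comment> \<open>Every term contains exactly one \<open>D\<close> or \<open>E\<close>, which
    starts in degree \<open>n\<close>; so all other factors contribute only their constant
    terms.\<close>
  from arg_cong[OF this[of "fps_const x1" "fps_const x2" "fps_const x3" "fps_const x4" for x1 x2 x3 x4],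
      of "\<lambda>X. fps_nth X n"]
  have LY5_n: "tr x1 x2 (d n x3 x4) + e n x1 x2 (br x3 x4) =
      br (e n x1 x2 x3) x4 + d n (tr x1 x2 x3) x4 + br x3 (e n x1 x2 x4) + d n x3 (tr x1 x2 x4)"
    for x1 x2 x3 x4
    by (simp add: nth_simps)
  have I: "delta_I br tr (d n) (e n) x1 x2 x3 x4 = 0" for x1 x2 x3 x4
    using LY5_n[of x1 x2 x3 x4] LY1[of x4 "e n x1 x2 x3"]
    by (simp add: delta_I_def algebra_simps)

  have "tr_t (P X) (P Y) (E U V W) + E X Y (fps_ext3 g U V W) =
      tr_t (E X Y U) (P V) (P W) + E (fps_ext3 g X Y U) V W +
      tr_t (P U) (E X Y V) (P W) + E U (fps_ext3 g X Y V) W +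
      tr_t (P U) (P V) (E X Y W) + E U V (fps_ext3 g X Y W)"
    for X Y U V W
    using arg_cong[OF t.LY6[of X Y U V W], of P]
    by (simp add: P.add PG tr_t_add tr_t_tr_t[of "P X" "P Y"] algebra_simps)
  from arg_cong[OF this[of "fps_const x1" "fps_const x2" "fps_const x3" "fps_const x4" "fps_const x5"
        for x1 x2 x3 x4 x5], of "\<lambda>X. fps_nth X n"]
  have LY6_n: "tr x1 x2 (e n x3 x4 x5) + e n x1 x2 (tr x3 x4 x5) =
      tr (e n x1 x2 x3) x4 x5 + e n (tr x1 x2 x3) x4 x5 + tr x3 (e n x1 x2 x4) x5 +
      e n x3 (tr x1 x2 x4) x5 + tr x3 x4 (e n x1 x2 x5) + e n x3 x4 (tr x1 x2 x5)"
    for x1 x2 x3 x4 x5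
    by (simp add: nth_simps)
  have II: "delta_II tr (e n) x1 x2 x3 x4 x5 = 0" for x1 x2 x3 x4 x5
    using LY6_n[of x1 x2 x3 x4 x5] LY2[of x3 "e n x1 x2 x4" x5]
    by (simp add: delta_II_def algebra_simps)
  show ?thesis
    using C2 C3 I II by (simp add: Z23_def delta_def fun_eq_iff d_def e_def)
qed

section \<open>Construction of the equivalence with the null deformation\<close>

lemma analytically_rigid_if_Z23_subset_B23:
  assumes two: "\<And>x::'m. x + x = 0 \<Longrightarrow> x = 0"
    and cob: "Z23 scale br tr \<subseteq> B23 scale br tr"
  shows "analytically_rigid scale br tr"
  unfolding analytically_rigid_def
proof (intro allI impI)
  fix f g assume fg: "formal_deformation scale br tr f g"
  then have fg0: "f 0 = br" "g 0 = tr" by (auto simp: formal_deformation_def)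
  define ok where "ok n \<phi> \<longleftrightarrow> (\<forall>i. module_hom scale scale (\<phi> i)) \<and> \<phi> 0 = id \<and>
      (\<forall>k\<le>n. defect2 br f \<phi> k = 0 \<and> defect3 tr g \<phi> k = 0)" for n \<phi>
  \<comment> \<open>Each correction depends on the earlier choices, hence dependent choice. A stage
    keeps the coefficients up to \<open>n\<close> of its predecessor.\<close>
  have "\<exists>\<Phi>. \<forall>n. ok n (\<Phi> n) \<and> (\<forall>k\<le>n. \<Phi> (Suc n) k = \<Phi> n k)"
  proof (rule dependent_nat_choice)
    have "{(i, j). i + j = 0} = {(0::nat, 0::nat)}"
      "{(i, j, k). i + j + k = 0} = {(0::nat, 0::nat, 0::nat)}"
      by auto
    moreover have "module_hom scale scale (const_series id i)" for i
      by (simp add: const_series_def module_hom_iff module_axioms)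
    ultimately have "ok 0 (const_series id)"
      by (simp add: ok_def defect2_def defect3_def const_series_def fg0 fun_eq_iff)
    then show "\<exists>\<phi>. ok 0 \<phi>" by (intro exI[of _ "const_series id"])
  next
    fix \<phi> n assume ok: "ok n \<phi>"
    then have "(defect2 br f \<phi> (Suc n), defect3 tr g \<phi> (Suc n)) \<in> Z23 scale br tr"
      using defect_in_Z23[OF two fg, of \<phi> "Suc n"] by (auto simp: ok_def less_Suc_eq_le)
    then obtain h where h: "module_hom scale scale h"
      "defect2 br f \<phi> (Suc n) = delta1_I br h" "defect3 tr g \<phi> (Suc n) = delta1_II tr h"
      using cob by (auto simp: B23_def C1_def)
    let ?\<psi> = "\<phi>(Suc n := \<lambda>x. \<phi> (Suc n) x + h x)"
    have "defect2 br f ?\<psi> k = 0 \<and> defect3 tr g ?\<psi> k = 0" if "k \<le> Suc n" for k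
    proof (cases "k = Suc n")
      case True
      then show ?thesis
        using ok defect2_update[of "Suc n" \<phi> f h] defect3_update[of "Suc n" \<phi> g h] fg0 h
        by (simp add: ok_def fun_eq_iff)
    next
      case False
      then have "defect2 br f ?\<psi> k = defect2 br f \<phi> k" "defect3 tr g ?\<psi> k = defect3 tr g \<phi> k"
        using that by (auto intro!: defect_cong)
      then show ?thesis using ok that False by (simp add: ok_def)
    qed
    moreover have "module_hom scale scale (?\<psi> i)" for i
      using ok h(1) by (auto simp: ok_def module_hom_iff algebra_simps)
    ultimately have "ok (Suc n) ?\<psi>" using ok by (simp add: ok_def)
    then show "\<exists>\<psi>. ok (Suc n) \<psi> \<and> (\<forall>k\<le>n. \<psi> k = \<phi> k)"
      by (intro exI[of _ ?\<psi>]) auto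
  qed
  then obtain \<Phi> where ok: "\<And>n. ok n (\<Phi> n)" and step: "\<And>n k. k \<le> n \<Longrightarrow> \<Phi> (Suc n) k = \<Phi> n k"
    by blast
  \<comment> \<open>The t-adic limit of the stages: coefficient \<open>k\<close> is final from stage
    \<open>k\<close> on.\<close>
  define \<phi> where "\<phi> k = \<Phi> k k" for k
  have agree: "\<phi> k = \<Phi> n k" if "k \<le> n" for n k
    using that by (induction n rule: dec_induct) (simp_all add: \<phi>_def step)
  have hom: "module_hom scale scale (\<phi> i)" for i
    using ok by (simp add: ok_def \<phi>_def)
  have \<phi>0: "\<phi> 0 = id"
    using ok by (simp add: ok_def \<phi>_def)
  have "defect2 br f \<phi> n = 0" "defect3 tr g \<phi> n = 0" for n
    using ok[of n] defect_cong[of n \<phi> "\<Phi> n"] agree by (auto simp: ok_def)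
  \<comment> \<open>These are the error terms in \<open>fps_ext1_fps_ext2\<close> and
    \<open>fps_ext1_fps_ext3\<close>; without them \<open>\<phi>\<close> intertwines the
    operations.\<close>
  then have "fps_ext2 (defect2 br f \<phi>) X Y = 0" "fps_ext3 (defect3 tr g \<phi>) X Y Z = 0" for X Y Z
    by (simp_all add: fps_eq_iff fps_ext2_def fps_ext3_def split_def)
  then show "trivial_deformation scale br tr f g"
    unfolding trivial_deformation_def equivalent_deformations_def
    using hom \<phi>0 fps_ext1_module_hom[OF module_axioms hom] bij_fps_ext1[of \<phi>, OF \<phi>0]
      fps_ext1_fps_ext2[OF hom bilinear, where f = f] fps_ext1_fps_ext3[OF hom trilinear, where g = g]
    by (intro exI[of _ \<phi>]) simp
qed

end

section \<open>From the vanishing quotient to rigidity\<close>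

theorem theorem2p10:
  fixes scale :: "'k::alg_closed_field \<Rightarrow> 'v::ab_group_add \<Rightarrow> 'v"
    and br :: "'v \<Rightarrow> 'v \<Rightarrow> 'v"
    and tr :: "'v \<Rightarrow> 'v \<Rightarrow> 'v \<Rightarrow> 'v"
  assumes "CHAR('k) \<noteq> 2" and "CHAR('k) \<noteq> 3"
    and "lie_yamaguti scale br tr"
    and "H23 scale br tr = {H23_zero scale br tr}"
  shows "analytically_rigid scale br tr"
proof -
  interpret lie_yamaguti scale br tr by fact
  have "(2::'k) \<noteq> 0"
  proof
    assume "(2::'k) = 0"
    then have "CHAR('k) dvd 2"
      using of_nat_eq_0_iff_char_dvd[of 2, where 'a = 'k] by simp
    then have "CHAR('k) = 1 \<or> CHAR('k) = 2"
      using two_is_prime_nat prime_nat_iff by blast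
    then show False using assms(1) CHAR_not_1 by auto
  qed
  have two: "x = 0" if "x + x = 0" for x :: 'v
  proof -
    have "scale (1 + 1) x = x + x" unfolding scale_left_distrib by simp
    then have "scale 2 x = 0" using that by simp
    then have "scale (inverse 2) (scale 2 x) = 0" by simp
    then show "x = 0" using \<open>(2::'k) \<noteq> 0\<close> by simp
  qed
  have "p \<in> B23 scale br tr" if "p \<in> Z23 scale br tr" for p
  proof -
    \<comment> \<open>A cocycle lies in its own class, which must be the zero class, and that class
      is the set of coboundaries.\<close>
    have "cohomologous scale br tr `` {p} \<in> H23 scale br tr"
      unfolding H23_def using that by (rule quotientI)
    then have "cohomologous scale br tr `` {p} = H23_zero scale br tr"
      by (simp only: assms(4) singleton_iff)
    then show ?thesis
      using equiv_class_self[OF equiv_cohomologous that] H23_zero_eq_B23[OF two]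
      by (simp only:)
  qed
  then show ?thesis
    using analytically_rigid_if_Z23_subset_B23[OF two] by blast
qed

end
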